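(* Let $n$ be a multiple of $8$. If $F$ is an $n$-vertex forest that has exactly $n/2$ leaves, and the leaves of $F$ are covered by $n/4$ pairwise vertex-disjoint copies of $P_4$ in $F$, then $\alpha'_g(F)=\frac{3}{4}\alpha'(F)=\frac{3}{8}n$.
   Context: Graphs are finite and simple. $P_4$ is the path with $4$ vertices; a copy of $P_4$ in $F$ is a subgraph of $F$ isomorphic to $P_4$. A leaf is a vertex of degree $1$. $\alpha'(G)$ denotes the maximum size of a matching in $G$. The matching game on a graph $G$: two players, Max and Min, alternately add edges of $G$ to a set of chosen edges that must always remain a matching; the game ends when the chosen edges form a maximal matching of $G$ (no further edge can be added). Max wants the final matching to be large, Min wants it to be small. $\alpha'_g(G)$ denotes the size of the final matching under optimal play when Max moves first. *)

theory Defs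
  imports Complex_Main "HOL-Library.Disjoint_Sets"
begin

record 'a graph =
  verts :: "'a set"
  edges :: "'a set set"

definition simple_graph :: "'a graph \<Rightarrow> bool" where
  "simple_graph G \<longleftrightarrow> finite (verts G) \<and> (\<forall>e\<in>edges G. e \<subseteq> verts G \<and> card e = 2)"

definition subgraph :: "'a graph \<Rightarrow> 'a graph \<Rightarrow> bool" where
  "subgraph H G \<longleftrightarrow> simple_graph H \<and> verts H \<subseteq> verts G \<and> edges H \<subseteq> edges G"

definition isomorphic :: "'a graph \<Rightarrow> 'b graph \<Rightarrow> bool" where
  "isomorphic G H \<longleftrightarrow> (\<exists>f. bij_betw f (verts G) (verts H) \<and>
     (\<forall>u\<in>verts G. \<forall>v\<in>verts G. {u, v} \<in> edges G \<longleftrightarrow> {f u, f v} \<in> edges H))"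

text \<open>The path with \<open>k\<close> vertices (so \<open>P\<^sub>4\<close> is \<open>path_graph 4\<close>).\<close>

definition path_graph :: "nat \<Rightarrow> nat graph" where
  "path_graph k = \<lparr>verts = {..<k}, edges = {{i, Suc i} |i. Suc i < k}\<rparr>"

text \<open>Copies need not be induced subgraphs.\<close>

definition copy_of_P4 :: "'a graph \<Rightarrow> 'a graph \<Rightarrow> bool" where
  "copy_of_P4 P G \<longleftrightarrow> subgraph P G \<and> isomorphic P (path_graph 4)"

definition is_cycle :: "'a graph \<Rightarrow> 'a list \<Rightarrow> bool" where
  "is_cycle G vs \<longleftrightarrow> length vs \<ge> 3 \<and> distinct vs \<and>
     (\<forall>i<length vs. {vs ! i, vs ! (Suc i mod length vs)} \<in> edges G)"

definition forest :: "'a graph \<Rightarrow> bool" where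
  "forest G \<longleftrightarrow> simple_graph G \<and> (\<nexists>vs. is_cycle G vs)"

definition degree :: "'a graph \<Rightarrow> 'a \<Rightarrow> nat" where
  "degree G v = card {e \<in> edges G. v \<in> e}"

definition leaves :: "'a graph \<Rightarrow> 'a set" where
  "leaves G = {v \<in> verts G. degree G v = 1}"

definition matching :: "'a graph \<Rightarrow> 'a set set \<Rightarrow> bool" where
  "matching G M \<longleftrightarrow> M \<subseteq> edges G \<and> disjoint M"

definition matching_number :: "'a graph \<Rightarrow> nat" where
  "matching_number G = Max (card ` {M. matching G M})"

definition legal_moves :: "'a graph \<Rightarrow> 'a set set \<Rightarrow> 'a set set" where
  "legal_moves G M = {e \<in> edges G - M. matching G (insert e M)}"

datatype player = Maximizer | Minimizer

text \<open>
  \<open>game_value G p M\<close> is the size of the final matching under optimal play when the edges in \<open>M\<close>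
  have been chosen so far and player \<open>p\<close> is to move.
  The test \<open>finite (edges G)\<close>, which holds for every simple graph, makes the recursion terminate.
\<close>

function game_value :: "'a graph \<Rightarrow> player \<Rightarrow> 'a set set \<Rightarrow> nat" where
  "game_value G p M =
     (if finite (edges G) \<and> legal_moves G M \<noteq> {} then
        (case p of
           Maximizer \<Rightarrow> Max ((\<lambda>e. game_value G Minimizer (insert e M)) ` legal_moves G M)
         | Minimizer \<Rightarrow> Min ((\<lambda>e. game_value G Maximizer (insert e M)) ` legal_moves G M))
      else card M)"
  by pat_completeness auto
termination
  by (relation "Wellfounded.measure (\<lambda>(G, p, M). card (edges G - M))")
    (auto simp: legal_moves_def simp del: card_Diff_insert intro!: psubset_card_mono)

declare game_value.simps [simp del]

definition game_matching_number :: "'a graph \<Rightarrow> nat" where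
  "game_matching_number G = game_value G Maximizer {}"

end

theory Submission imports Defs begin

text \<open>
  Each of the disjoint paths \<open>a b c d\<close> contains at most two leaves of the forest, so by counting the
  paths span the forest and their end vertices are exactly the leaves. Hence the forest arises from
  a forest \<open>T\<close> on a set \<open>K\<close> of \<open>n/2\<close> vertices by attaching one pendant edge at every vertex, and
  the middle edges \<open>b c\<close> form a perfect matching \<open>Q\<close> of \<open>T\<close>. A maximal matching covers \<open>K\<close>, so its
  size is \<open>n/2\<close> minus the number of its edges in \<open>T\<close>.

  Min plays an untouched edge of \<open>Q\<close> whenever there is one. A move of Max touches at most one edge
  of \<open>Q\<close>, or at most two if it uses an edge of \<open>T\<close> itself, so at least \<open>n/8\<close> edges of \<open>T\<close> are used.
  Max plays the pendant edge at the neighbour of a leaf of what remains of \<open>T\<close>. This makes at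
  least two vertices of \<open>T\<close> useless for later moves in \<open>T\<close>, and so does every edge of \<open>T\<close> that Min
  plays; hence at most \<open>n/8\<close> edges of \<open>T\<close> are used.
\<close>

section \<open>Graphs and the matching game\<close>

lemma simple_graph_finite_edges:
  assumes "simple_graph G"
  shows "finite (edges G)"
proof (rule finite_subset)
  show "edges G \<subseteq> Pow (verts G)"
    using assms by (auto simp: simple_graph_def)
  show "finite (Pow (verts G))"
    using assms by (simp add: simple_graph_def)
qed

text \<open>Edges are nonempty, so avoiding the vertices covered by \<open>M\<close> already rules
  out membership in \<open>M\<close>.\<close>

lemma legal_moves_iff:
  assumes "simple_graph G" "matching G M"
  shows "e \<in> legal_moves G M \<longleftrightarrow> e \<in> edges G \<and> e \<inter> \<Union>M = {}"
proof
  assume e: "e \<in> legal_moves G M"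
  then have "e \<in> edges G" "e \<notin> M" "disjoint (insert e M)"
    by (auto simp: legal_moves_def matching_def)
  then show "e \<in> edges G \<and> e \<inter> \<Union>M = {}"
    by (fastforce simp: pairwise_insert disjnt_def)
next
  assume e: "e \<in> edges G \<and> e \<inter> \<Union>M = {}"
  then have "card e = 2"
    using assms by (auto simp: simple_graph_def)
  then have "e \<noteq> {}" by auto
  then have "e \<notin> M" using e by blast
  moreover have "disjoint (insert e M)"
    using e assms(2) by (auto simp: matching_def pairwise_insert disjnt_def)
  ultimately show "e \<in> legal_moves G M"
    using e assms(2) by (auto simp: legal_moves_def matching_def)
qed

lemma matching_finite:
  assumes "simple_graph G" "matching G M"
  shows "finite M"
  using assms simple_graph_finite_edges finite_subset by (auto simp: matching_def)

lemma matching_insert_legal: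
  "e \<in> legal_moves G M \<Longrightarrow> matching G (insert e M)"
  by (simp add: legal_moves_def)

lemma finite_legal_moves:
  "finite (edges G) \<Longrightarrow> finite (legal_moves G M)"
  by (simp add: legal_moves_def)

text \<open>Max follows the moves that keep \<Phi> from falling, and no move of Min can lower it; so
  \<Phi> at the end, hence the final size, is at least \<Phi> now. Strategies never have to be
  formalized.\<close>

lemma game_value_ge_potential:
  fixes \<Phi> :: "player \<Rightarrow> 'a set set \<Rightarrow> int"
  assumes fin: "finite (edges G)"
    and final: "\<And>p M. matching G M \<Longrightarrow> legal_moves G M = {} \<Longrightarrow> \<Phi> p M \<le> int (card M)"
    and maxi: "\<And>M. matching G M \<Longrightarrow> legal_moves G M \<noteq> {} \<Longrightarrow>
                 \<exists>e\<in>legal_moves G M. \<Phi> Maximizer M \<le> \<Phi> Minimizer (insert e M)"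
    and mini: "\<And>M e. matching G M \<Longrightarrow> e \<in> legal_moves G M \<Longrightarrow>
                 \<Phi> Minimizer M \<le> \<Phi> Maximizer (insert e M)"
    and "matching G M"
  shows "\<Phi> p M \<le> int (game_value G p M)"
  using fin \<open>matching G M\<close> final maxi mini
proof (induction G p M rule: game_value.induct)
  case (1 G p M)
  note IHmax = "1.IH"(1) and IHmin = "1.IH"(2) and prems = "1.prems"
  note M = prems(2)
  show ?case
  proof (cases "legal_moves G M = {}")
    case True
    then show ?thesis
      using prems(3)[OF M True] by (simp add: game_value.simps)
  next
    case False
    have fL: "finite (legal_moves G M)"
      using prems(1) by (rule finite_legal_moves)
    show ?thesis
    proof (cases p)
      case Maximizer
      obtain e where e: "e \<in> legal_moves G M" "\<Phi> Maximizer M \<le> \<Phi> Minimizer (insert e M)"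
        using prems(4)[OF M False] by blast
      have "\<Phi> Minimizer (insert e M) \<le> int (game_value G Minimizer (insert e M))"
        using False prems(1)
        by (intro IHmax[OF _ Maximizer e(1) prems(1) matching_insert_legal[OF e(1)] prems(3-5)] conjI)
      also have "game_value G Minimizer (insert e M) \<le> game_value G p M"
        using False prems(1) fL e Maximizer
        by (subst (2) game_value.simps) (auto intro!: Max_ge)
      finally show ?thesis using e Maximizer by simp
    next
      case Minimizer
      have "game_value G p M \<in> (\<lambda>e. game_value G Maximizer (insert e M)) ` legal_moves G M"
        using False prems(1) fL Minimizer
        by (subst game_value.simps) (auto intro!: Min_in)
      then obtain e where e: "e \<in> legal_moves G M"
          "game_value G p M = game_value G Maximizer (insert e M)"
        by blast
      have "\<Phi> Maximizer (insert e M) \<le> int (game_value G Maximizer (insert e M))"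
        using False prems(1)
        by (intro IHmin[OF _ Minimizer e(1) prems(1) matching_insert_legal[OF e(1)] prems(3-5)] conjI)
      then show ?thesis
        using prems(5)[OF M e(1)] e Minimizer by simp
    qed
  qed
qed

text \<open>The dual principle, with Min keeping \<Phi> from rising.\<close>

lemma game_value_le_potential:
  fixes \<Phi> :: "player \<Rightarrow> 'a set set \<Rightarrow> int"
  assumes fin: "finite (edges G)"
    and final: "\<And>p M. matching G M \<Longrightarrow> legal_moves G M = {} \<Longrightarrow> int (card M) \<le> \<Phi> p M"
    and mini: "\<And>M. matching G M \<Longrightarrow> legal_moves G M \<noteq> {} \<Longrightarrow>
                 \<exists>e\<in>legal_moves G M. \<Phi> Maximizer (insert e M) \<le> \<Phi> Minimizer M"
    and maxi: "\<And>M e. matching G M \<Longrightarrow> e \<in> legal_moves G M \<Longrightarrow>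
                 \<Phi> Minimizer (insert e M) \<le> \<Phi> Maximizer M"
    and "matching G M"
  shows "int (game_value G p M) \<le> \<Phi> p M"
  using fin \<open>matching G M\<close> final mini maxi
proof (induction G p M rule: game_value.induct)
  case (1 G p M)
  note IHmax = "1.IH"(1) and IHmin = "1.IH"(2) and prems = "1.prems"
  note M = prems(2)
  show ?case
  proof (cases "legal_moves G M = {}")
    case True
    then show ?thesis
      using prems(3)[OF M True] by (simp add: game_value.simps)
  next
    case False
    have fL: "finite (legal_moves G M)"
      using prems(1) by (rule finite_legal_moves)
    show ?thesis
    proof (cases p)
      case Minimizer
      obtain e where e: "e \<in> legal_moves G M" "\<Phi> Maximizer (insert e M) \<le> \<Phi> Minimizer M"
        using prems(4)[OF M False] by blast
      have "game_value G p M \<le> game_value G Maximizer (insert e M)"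
        using False prems(1) fL e Minimizer
        by (subst game_value.simps) (auto intro!: Min_le)
      also have "int (game_value G Maximizer (insert e M)) \<le> \<Phi> Maximizer (insert e M)"
        using False prems(1)
        by (intro IHmin[OF _ Minimizer e(1) prems(1) matching_insert_legal[OF e(1)] prems(3-5)] conjI)
      finally show ?thesis using e Minimizer by simp
    next
      case Maximizer
      have "game_value G p M \<in> (\<lambda>e. game_value G Minimizer (insert e M)) ` legal_moves G M"
        using False prems(1) fL Maximizer
        by (subst game_value.simps) (auto intro!: Max_in)
      then obtain e where e: "e \<in> legal_moves G M"
          "game_value G p M = game_value G Minimizer (insert e M)"
        by blast
      have "int (game_value G Minimizer (insert e M)) \<le> \<Phi> Minimizer (insert e M)"
        using False prems(1)
        by (intro IHmax[OF _ Maximizer e(1) prems(1) matching_insert_legal[OF e(1)] prems(3-5)] conjI)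
      then show ?thesis
        using prems(5)[OF M e(1)] e Maximizer by simp
    qed
  qed
qed

section \<open>Leaves of subforests\<close>

text \<open>The first vertex of a longest path is a leaf.\<close>

lemma forest_subset_leaf:
  assumes "forest G" "H \<subseteq> edges G" "H \<noteq> {}"
  obtains u w where "{u, w} \<in> H" "u \<noteq> w" "\<And>x. {u, x} \<in> H \<Longrightarrow> x = w"
proof -
  have simple: "simple_graph G" and acyclic: "\<And>vs. \<not> is_cycle G vs"
    using assms(1) by (auto simp: forest_def)
  have H: "\<And>e. e \<in> H \<Longrightarrow> card e = 2 \<and> e \<subseteq> verts G"
    using assms(2) simple by (auto simp: simple_graph_def)
  define path where "path = (\<lambda>vs. 2 \<le> length vs \<and> distinct vs \<and>
      (\<forall>i. Suc i < length vs \<longrightarrow> {vs ! i, vs ! Suc i} \<in> H))"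
  obtain e where "e \<in> H" using assms(3) by blast
  then obtain a b where ab: "{a, b} \<in> H" "a \<noteq> b"
    using H by (metis card_2_iff)
  then have start: "path [a, b]"
    by (auto simp: path_def less_Suc_eq)
  have in_verts: "set vs \<subseteq> verts G" if vs: "path vs" for vs
  proof
    fix x assume "x \<in> set vs"
    then obtain i where i: "i < length vs" "x = vs ! i"
      by (auto simp: in_set_conv_nth)
    show "x \<in> verts G"
    proof (cases "Suc i < length vs")
      case True
      then have "{vs ! i, vs ! Suc i} \<in> H" using vs by (auto simp: path_def)
      then show ?thesis using H i by blast
    next
      case False
      then obtain j where j: "i = Suc j" using i vs by (cases i) (auto simp: path_def)
      then have "{vs ! j, vs ! Suc j} \<in> H" using vs i by (auto simp: path_def)
      then show ?thesis using H i j by blast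
    qed
  qed
  have bound: "length vs \<le> card (verts G)" if "path vs" for vs
    using in_verts[OF that] that card_mono[of "verts G" "set vs"] simple
    by (auto simp: path_def simple_graph_def distinct_card)
  have "\<exists>vs. path vs \<and> (\<forall>us. path us \<longrightarrow> length us \<le> length vs)"
    using ex_has_greatest_nat[of path "[a, b]" length "Suc (card (verts G))"] start bound
    by (metis le_imp_less_Suc)
  then obtain vs where vs: "path vs" and longest: "\<And>us. path us \<Longrightarrow> length us \<le> length vs"
    by blast
  then obtain u w ws where uw: "vs = u # w # ws"
    by (metis path_def Suc_le_length_iff numeral_2_eq_2)
  have edge: "{u, w} \<in> H" "u \<noteq> w"
    using vs unfolding uw path_def by auto
  have "x = w" if x: "{u, x} \<in> H" for x
  proof (rule ccontr)
    assume "x \<noteq> w"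
    have "x \<noteq> u" using H[OF x] by auto
    show False
    \<comment> \<open>A second neighbour \<open>x\<close> off the path would extend it at the front;
      on the path, it would close a cycle with the initial segment ending in
      \<open>x\<close>.\<close>
    proof (cases "x \<in> set vs")
      case False
      have "path (x # vs)"
        unfolding path_def
      proof (intro conjI allI impI)
        fix i assume "Suc i < length (x # vs)"
        then show "{(x # vs) ! i, (x # vs) ! Suc i} \<in> H"
          using vs x by (cases i) (auto simp: path_def uw insert_commute)
      qed (use vs False in \<open>auto simp: path_def\<close>)
      then show False using longest by force
    next
      case True
      then obtain j where j: "j < length vs" "x = vs ! j"
        by (auto simp: in_set_conv_nth)
      have "vs ! 0 = u" "vs ! 1 = w" using uw by simp_all
      then have "j \<noteq> 0" "j \<noteq> 1"
        using \<open>x \<noteq> u\<close> \<open>x \<noteq> w\<close> j(2) by metis+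
      \<comment> \<open>This makes the closed walk have at least three vertices, as
        \<open>is_cycle\<close> demands.\<close>
      then have j2: "j \<ge> 2" by simp
      have len: "length (take (Suc j) vs) = Suc j" using j by simp
      have "is_cycle G (take (Suc j) vs)"
        unfolding is_cycle_def len
      proof (intro conjI allI impI)
        show "3 \<le> Suc j" using j2 by simp
        show "distinct (take (Suc j) vs)" using vs by (simp add: path_def)
        fix i assume i: "i < Suc j"
        show "{take (Suc j) vs ! i, take (Suc j) vs ! (Suc i mod Suc j)} \<in> edges G"
        proof (cases "i = j")
          case True
          then have "take (Suc j) vs ! i = x" "take (Suc j) vs ! (Suc i mod Suc j) = u"
            using j \<open>vs ! 0 = u\<close> by simp_all
          then show ?thesis using x assms(2) by (auto simp: insert_commute)
        next
          case False
          then have "Suc i < Suc j" using i by simp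
          then show ?thesis using vs j assms(2) by (auto simp: path_def)
        qed
      qed
      then show False using acyclic by blast
    qed
  qed
  then show thesis using that edge by blast
qed

section \<open>Graphs with one pendant edge at every core vertex\<close>

text \<open>The corona of the graph induced on \<open>K\<close> with a single vertex:
  \<open>l v\<close> is the leaf hung at \<open>v\<close>. Any further vertices are isolated and do
  not affect the game.\<close>

locale corona =
  fixes G :: "'a graph" and K :: "'a set" and l :: "'a \<Rightarrow> 'a"
  assumes simple: "simple_graph G"
    and core_verts: "K \<subseteq> verts G"
    and pendant: "v \<in> K \<Longrightarrow> {v, l v} \<in> edges G"
    and pendant_outside: "v \<in> K \<Longrightarrow> l v \<notin> K"
    and pendant_inj: "inj_on l K"
    and edge_cases: "e \<in> edges G \<Longrightarrow> e \<subseteq> K \<or> (\<exists>v\<in>K. e = {v, l v})"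
begin

lemma finite_core: "finite K"
  using simple core_verts finite_subset by (auto simp: simple_graph_def)

lemma card_edge: "e \<in> edges G \<Longrightarrow> card e = 2"
  using simple by (auto simp: simple_graph_def)

lemma card_edge_Int_core:
  assumes "e \<in> edges G"
  shows "card (e \<inter> K) = (if e \<subseteq> K then 2 else 1)"
proof (cases "e \<subseteq> K")
  case True
  then show ?thesis using card_edge[OF assms] by (simp add: Int_absorb2)
next
  case False
  then obtain v where v: "v \<in> K" "e = {v, l v}" using edge_cases[OF assms] by blast
  then have "e \<inter> K = {v}" using pendant_outside by auto
  then show ?thesis using False by simp
qed

section \<open>Core edges and the size of matchings\<close>

definition core_edges :: "'a set set \<Rightarrow> 'a set set" where
  "core_edges M = {e \<in> M. e \<subseteq> K}"

text \<open>Count the covered core vertices edge by edge: a core edge covers two of them, a pendant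
  edge one.\<close>

lemma card_matching_plus_core:
  assumes M: "matching G M"
  shows "card M + card (core_edges M) = card (\<Union>M \<inter> K)"
proof -
  have fin: "finite M" using matching_finite[OF simple M] .
  have ME: "M \<subseteq> edges G" and dis: "disjoint M" using M by (auto simp: matching_def)
  have "\<Union>M \<inter> K = (\<Union>e\<in>M. e \<inter> K)" by blast
  also have "card \<dots> = (\<Sum>e\<in>M. card (e \<inter> K))"
    using fin finite_core dis by (intro card_UN_disjoint) (auto simp: disjoint_def)
  also have "\<dots> = (\<Sum>e\<in>M. 1 + (if e \<subseteq> K then 1 else 0))"
    using card_edge_Int_core[OF subsetD[OF ME]] by (intro sum.cong) simp_all
  also have "\<dots> = card M + card (core_edges M)"
    unfolding sum.distrib core_edges_def using fin by (simp add: sum.If_cases Int_def)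
  finally show ?thesis by simp
qed

text \<open>Every edge uses a core vertex, which bounds all matchings; the pendant edges attain the
  bound.\<close>

lemma matching_number_eq: "matching_number G = card K"
  unfolding matching_number_def
proof (rule Max_eqI)
  have "finite {M. matching G M}"
    using simple_graph_finite_edges[OF simple] by (simp add: matching_def)
  then show "finite (card ` {M. matching G M})" by simp
next
  fix y assume "y \<in> card ` {M. matching G M}"
  then obtain M where M: "matching G M" "y = card M" by blast
  have "card (\<Union>M \<inter> K) \<le> card K" using finite_core by (intro card_mono) auto
  then show "y \<le> card K" using card_matching_plus_core[OF M(1)] M(2) by simp
next
  let ?M = "(\<lambda>v. {v, l v}) ` K"
  have "matching G ?M"
    using pendant pendant_outside pendant_inj
    by (auto simp: matching_def disjoint_def inj_on_def)
  moreover have "inj_on (\<lambda>v. {v, l v}) K"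
    using pendant_outside by (auto simp: inj_on_def doubleton_eq_iff)
  then have "card ?M = card K" by (rule card_image)
  ultimately show "card K \<in> card ` {M. matching G M}" by (intro image_eqI[of _ _ ?M]) auto
qed

text \<open>The only edge at \<open>l v\<close> is \<open>{v, l v}\<close>, so \<open>l v\<close>
  cannot be covered while \<open>v\<close> is free. Thus play goes on until all of \<open>K\<close>
  is covered.\<close>

lemma pendant_legal:
  assumes M: "matching G M" and v: "v \<in> K" "v \<notin> \<Union>M"
  shows "{v, l v} \<in> legal_moves G M"
proof -
  have "l v \<notin> \<Union>M"
  proof
    assume "l v \<in> \<Union>M"
    then obtain e where e: "e \<in> M" "l v \<in> e" by blast
    then have "e \<in> edges G" using M by (auto simp: matching_def)
    then obtain w where w: "w \<in> K" "e = {w, l w}"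
      using edge_cases e(2) pendant_outside[OF v(1)] by blast
    then have "l v = l w" using e pendant_outside[OF v(1)] by auto
    then have "v = w" using v w pendant_inj by (auto simp: inj_on_def)
    then show False using v e w by blast
  qed
  then show ?thesis using legal_moves_iff[OF simple M] pendant v by auto
qed

text \<open>The final size of the matching depends only on how many core edges were chosen.\<close>

lemma maximal_matching_card:
  assumes M: "matching G M" and "legal_moves G M = {}"
  shows "card M + card (core_edges M) = card K"
proof -
  have "K \<subseteq> \<Union>M" using pendant_legal[OF M] assms(2) by blast
  then show ?thesis using card_matching_plus_core[OF M] by (simp add: Int_absorb1)
qed

lemma card_core_edges_insert:
  assumes M: "matching G M" and e: "e \<in> legal_moves G M"
  shows "card (core_edges (insert e M)) = card (core_edges M) + (if e \<subseteq> K then 1 else 0)"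
proof -
  have "e \<notin> M" using e by (auto simp: legal_moves_def)
  moreover have "core_edges (insert e M) = (if e \<subseteq> K then insert e (core_edges M) else core_edges M)"
    by (auto simp: core_edges_def)
  ultimately show ?thesis
    using matching_finite[OF simple M] by (auto simp: core_edges_def)
qed

section \<open>Core edges that can still be played\<close>

definition residual_edges :: "'a set set \<Rightarrow> 'a set set" where
  "residual_edges M = {e \<in> edges G. e \<subseteq> K \<and> e \<inter> \<Union>M = {}}"

text \<open>An uncovered core vertex without a playable core edge is not live: it can only be
  matched to its own leaf. The number of live vertices is the resource that core moves
  consume.\<close>

definition live :: "'a set set \<Rightarrow> 'a set" where
  "live M = \<Union>(residual_edges M)"

lemma finite_live: "finite (live M)"
  using finite_core by (rule finite_subset[rotated]) (auto simp: live_def residual_edges_def)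

lemma live_insert_subset: "live (insert e M) \<subseteq> live M - e"
  by (auto simp: live_def residual_edges_def)

lemma card_live_drop:
  assumes "card A = 2" "A \<subseteq> live M" "live M' \<subseteq> live M - A"
  shows "card (live M') + 2 \<le> card (live M)"
proof -
  have "finite A" using assms(1) card.infinite by fastforce
  then have "card (live M - A) = card (live M) - 2"
    using assms by (simp add: card_Diff_subset)
  moreover have "card (live M') \<le> card (live M - A)"
    using assms(3) finite_live by (intro card_mono) auto
  moreover have "2 \<le> card (live M)"
    using card_mono[OF finite_live assms(2)] assms(1) by simp
  ultimately show ?thesis by simp
qed

lemma core_move_live:
  assumes M: "matching G M" and e: "e \<in> legal_moves G M" "e \<subseteq> K"
  shows "card (live (insert e M)) + 2 \<le> card (live M)"
proof (rule card_live_drop)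
  have "e \<in> residual_edges M"
    using e legal_moves_iff[OF simple M] by (auto simp: residual_edges_def)
  then show "e \<subseteq> live M" by (auto simp: live_def)
  show "card e = 2" using e card_edge by (auto simp: legal_moves_def)
qed (rule live_insert_subset)

text \<open>Occupying the neighbour of a leaf of the residual core forest also isolates that leaf.\<close>

lemma pendant_move_live:
  assumes "forest G" and M: "matching G M" and "live M \<noteq> {}"
  obtains e where "e \<in> legal_moves G M" "\<not> e \<subseteq> K"
    "card (live (insert e M)) + 2 \<le> card (live M)"
proof -
  have "residual_edges M \<noteq> {}" "residual_edges M \<subseteq> edges G"
    using assms(3) by (auto simp: live_def residual_edges_def)
  then obtain u w where uw: "{u, w} \<in> residual_edges M" "u \<noteq> w"
      "\<And>x. {u, x} \<in> residual_edges M \<Longrightarrow> x = w"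
    using forest_subset_leaf[OF \<open>forest G\<close>] by metis
  have w: "w \<in> K" "w \<notin> \<Union>M" using uw(1) by (auto simp: residual_edges_def)
  let ?M = "insert {w, l w} M"
  have "u \<notin> live ?M"
  proof
    assume "u \<in> live ?M"
    then obtain e where e: "e \<in> residual_edges ?M" "u \<in> e" by (auto simp: live_def)
    then have "card e = 2" using card_edge by (auto simp: residual_edges_def)
    then obtain x where x: "e = {u, x}" using e(2) by (auto simp: card_2_iff)
    have "e \<in> residual_edges M" using e(1) by (auto simp: residual_edges_def)
    then have "x = w" using uw(3) x by blast
    then show False using e x by (auto simp: residual_edges_def)
  qed
  then have "live ?M \<subseteq> live M - {u, w}"
    using live_insert_subset[of "{w, l w}" M] by blast
  moreover have "{u, w} \<subseteq> live M" using uw(1) by (auto simp: live_def)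
  ultimately have "card (live ?M) + 2 \<le> card (live M)"
    using uw(2) by (intro card_live_drop) auto
  then show thesis
    using that pendant_legal[OF M w] pendant_outside[OF w(1)] by blast
qed

text \<open>A move of Max and a reply of Min on a core edge together destroy at least four live
  vertices, so one core edge is charged to four core vertices.\<close>

lemma game_value_lower:
  assumes "forest G"
  shows "card K \<le> game_matching_number G + card K div 4"
proof -
  \<comment> \<open>The \<open>div\<close> term bounds the core edges still to come. The extra 2
    when Min is to move credits the two live vertices destroyed by Max's preceding move.\<close>
  define \<Phi> where "\<Phi> = (\<lambda>p M. int (card K) - int (card (core_edges M))
      - int ((card (live M) + (case p of Maximizer \<Rightarrow> 0 | Minimizer \<Rightarrow> 2)) div 4))"
  have "\<Phi> Maximizer {} \<le> int (game_value G Maximizer {})"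
  proof (rule game_value_ge_potential)
    show "finite (edges G)" using simple by (rule simple_graph_finite_edges)
    show "matching G {}" by (simp add: matching_def)
  next
    fix p M assume "matching G M" "legal_moves G M = {}"
    then show "\<Phi> p M \<le> int (card M)"
      using maximal_matching_card[of M] by (simp add: \<Phi>_def)
  next
    fix M assume M: "matching G M" "legal_moves G M \<noteq> {}"
    show "\<exists>e\<in>legal_moves G M. \<Phi> Maximizer M \<le> \<Phi> Minimizer (insert e M)"
    proof (cases "live M = {}")
      \<comment> \<open>Only pendant edges remain, so any move will do; the credit vanishes because
        \<open>2 div 4 = 0\<close>.\<close>
      case True
      obtain e where e: "e \<in> legal_moves G M" using M by blast
      have "\<not> e \<subseteq> K" using core_move_live[OF M(1) e] True by auto
      moreover have "live (insert e M) = {}" using live_insert_subset[of e M] True by blast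
      ultimately have "\<Phi> Maximizer M \<le> \<Phi> Minimizer (insert e M)"
        using card_core_edges_insert[OF M(1) e] True by (simp add: \<Phi>_def)
      then show ?thesis using e by blast
    next
      case False
      obtain e where e: "e \<in> legal_moves G M" "\<not> e \<subseteq> K"
          and drop: "card (live (insert e M)) + 2 \<le> card (live M)"
        using pendant_move_live[OF assms M(1) False] by blast
      have "(card (live (insert e M)) + 2) div 4 \<le> card (live M) div 4"
        using drop by (rule div_le_mono)
      then have "\<Phi> Maximizer M \<le> \<Phi> Minimizer (insert e M)"
        using card_core_edges_insert[OF M(1) e(1)] e(2) by (simp add: \<Phi>_def)
      then show ?thesis using e by blast
    qed
  next
    fix M e assume M: "matching G M" and e: "e \<in> legal_moves G M"
    show "\<Phi> Minimizer M \<le> \<Phi> Maximizer (insert e M)"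
    proof (cases "e \<subseteq> K")
      case True
      \<comment> \<open>Two live vertices lost and the credit of 2 spent make up the 4 that pay for
        Min's core edge.\<close>
      have "(card (live (insert e M)) + 2 + 2) div 4 \<le> (card (live M) + 2) div 4"
        using core_move_live[OF M e True] by (intro div_le_mono) simp
      then show ?thesis
        using card_core_edges_insert[OF M e] True by (simp add: \<Phi>_def)
    next
      case False
      have "card (live (insert e M)) \<le> card (live M)"
        using live_insert_subset[of e M] finite_live by (intro card_mono) auto
      then have "card (live (insert e M)) div 4 \<le> (card (live M) + 2) div 4"
        by (intro div_le_mono) simp
      then show ?thesis
        using card_core_edges_insert[OF M e] False by (simp add: \<Phi>_def)
    qed
  qed
  moreover have "card (live {}) \<le> card K"
    using finite_core by (intro card_mono) (auto simp: live_def residual_edges_def)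
  then have "card (live {}) div 4 \<le> card K div 4" by (rule div_le_mono)
  ultimately show ?thesis
    by (simp add: \<Phi>_def game_matching_number_def core_edges_def)
qed

text \<open>Min plays an edge of \<open>Q\<close> with both ends uncovered as long as there is one.
  A pendant move of Max spoils at most one such edge; a core move spoils at most two but is itself a
  core edge.\<close>

lemma game_value_upper:
  assumes Q: "matching G Q" "\<Union>Q \<subseteq> K"
  shows "game_matching_number G + card Q div 2 \<le> card K"
proof -
  define free where "free = (\<lambda>M. {q \<in> Q. q \<inter> \<Union>M = {}})"
  \<comment> \<open>Here the \<open>div\<close> term is the number of core edges Min can still
    guarantee: one for every two free edges of \<open>Q\<close>, rounded up if Min moves
    next.\<close>
  define \<Phi> where "\<Phi> = (\<lambda>p M. int (card K) - int (card (core_edges M))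
      - int ((card (free M) + (case p of Maximizer \<Rightarrow> 0 | Minimizer \<Rightarrow> 1)) div 2))"
  have finQ: "finite Q" using matching_finite[OF simple Q(1)] .
  then have fin_free: "finite (free M)" for M by (simp add: free_def)
  have Q_disj: "q = q'" if "q \<in> Q" "q' \<in> Q" "x \<in> q" "x \<in> q'" for q q' x
    using Q(1) that by (auto simp: matching_def disjoint_def)
  have hits: "card {q \<in> Q. x \<in> q} \<le> 1" for x
    using finQ Q_disj by (auto simp: card_le_Suc0_iff_eq)
  have QE: "q \<in> edges G" "q \<noteq> {}" if "q \<in> Q" for q
    using Q(1) that card_edge[of q] by (auto simp: matching_def)
  \<comment> \<open>Edges of \<open>Q\<close> lie in \<open>K\<close> and are disjoint, so each core
    vertex of \<open>e\<close> spoils at most one of them.\<close>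
  have free_insert: "card (free M) \<le> card (free (insert e M)) + card (e \<inter> K)"
    if e: "e \<in> edges G" for e M
  proof -
    have fe: "finite (e \<inter> K)" using finite_core by simp
    have "free M \<subseteq> free (insert e M) \<union> (\<Union>x\<in>e \<inter> K. {q \<in> Q. x \<in> q})"
      using Q(2) by (auto simp: free_def)
    then have "card (free M) \<le> card (free (insert e M) \<union> (\<Union>x\<in>e \<inter> K. {q \<in> Q. x \<in> q}))"
      using fin_free finQ fe by (intro card_mono) auto
    also have "\<dots> \<le> card (free (insert e M)) + card (\<Union>x\<in>e \<inter> K. {q \<in> Q. x \<in> q})"
      by (rule card_Un_le)
    also have "card (\<Union>x\<in>e \<inter> K. {q \<in> Q. x \<in> q}) \<le> (\<Sum>x\<in>e \<inter> K. card {q \<in> Q. x \<in> q})"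
      using fe by (rule card_UN_le)
    also have "\<dots> \<le> (\<Sum>x\<in>e \<inter> K. 1)" using hits by (intro sum_mono) auto
    finally show ?thesis by simp
  qed
  have "int (game_value G Maximizer {}) \<le> \<Phi> Maximizer {}"
  proof (rule game_value_le_potential)
    show "finite (edges G)" using simple by (rule simple_graph_finite_edges)
    show "matching G {}" by (simp add: matching_def)
  next
    fix p M assume M: "matching G M" "legal_moves G M = {}"
    \<comment> \<open>A free edge would be a legal move. The \<open>div\<close> term is then 0 for
      both players, as \<open>1 div 2 = 0\<close>.\<close>
    have "free M = {}"
      using M QE legal_moves_iff[OF simple M(1)] by (auto simp: free_def)
    then show "int (card M) \<le> \<Phi> p M"
      using maximal_matching_card[OF M] by (cases p) (auto simp: \<Phi>_def)
  next
    fix M assume M: "matching G M" "legal_moves G M \<noteq> {}"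
    show "\<exists>e\<in>legal_moves G M. \<Phi> Maximizer (insert e M) \<le> \<Phi> Minimizer M"
    proof (cases "free M = {}")
      case True
      obtain e where e: "e \<in> legal_moves G M" using M by blast
      have "\<Phi> Maximizer (insert e M) \<le> \<Phi> Minimizer M"
        using card_core_edges_insert[OF M(1) e] True by (simp add: \<Phi>_def)
      then show ?thesis using e by blast
    next
      case False
      then obtain q where q: "q \<in> free M" by blast
      then have qQ: "q \<in> Q" "q \<subseteq> K" using Q(2) by (auto simp: free_def)
      have e: "q \<in> legal_moves G M"
        using q QE legal_moves_iff[OF simple M(1)] by (auto simp: free_def)
      have "free M \<subseteq> insert q (free (insert q M))"
        using q Q_disj by (auto simp: free_def)
      then have "card (free M) \<le> card (insert q (free (insert q M)))"
        using fin_free by (intro card_mono) auto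
      also have "\<dots> \<le> Suc (card (free (insert q M)))"
        using fin_free by (simp add: card_insert_if)
      finally have "(card (free M) + 1) div 2 \<le> (card (free (insert q M)) + 2) div 2"
        by (intro div_le_mono) simp
      then have "\<Phi> Maximizer (insert q M) \<le> \<Phi> Minimizer M"
        using card_core_edges_insert[OF M(1) e] qQ by (simp add: \<Phi>_def)
      then show ?thesis using e by blast
    qed
  next
    fix M e assume M: "matching G M" and e: "e \<in> legal_moves G M"
    have eE: "e \<in> edges G" using e by (simp add: legal_moves_def)
    show "\<Phi> Minimizer (insert e M) \<le> \<Phi> Maximizer M"
    proof (cases "e \<subseteq> K")
      case True
      \<comment> \<open>At most two free edges are lost, and the 2 is paid for by Max's own core
        edge; the 1 belongs to Min's turn.\<close>
      then have "card (free M) div 2 \<le> (card (free (insert e M)) + 1 + 2) div 2"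
        using free_insert[OF eE, of M] card_edge_Int_core[OF eE] by (intro div_le_mono) simp
      then show ?thesis
        using card_core_edges_insert[OF M e] True by (simp add: \<Phi>_def)
    next
      case False
      then have "card (free M) div 2 \<le> (card (free (insert e M)) + 1) div 2"
        using free_insert[OF eE, of M] card_edge_Int_core[OF eE] by (intro div_le_mono) simp
      then show ?thesis
        using card_core_edges_insert[OF M e] False by (simp add: \<Phi>_def)
    qed
  qed
  moreover have "free {} = Q" by (simp add: free_def)
  moreover have "card Q \<le> card K"
  proof -
    have "card Q \<le> card (\<Union>Q \<inter> K)" using card_matching_plus_core[OF Q(1)] by simp
    also have "\<dots> \<le> card K" using finite_core by (intro card_mono) auto
    finally show ?thesis .
  qed
  ultimately show ?thesis
    by (simp add: \<Phi>_def game_matching_number_def core_edges_def)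
qed

end

section \<open>Forests whose leaves are covered by disjoint four-vertex paths\<close>

lemma copy_of_P4E:
  assumes "copy_of_P4 P G"
  obtains a b c d where "distinct [a, b, c, d]" "verts P = {a, b, c, d}" "verts P \<subseteq> verts G"
    "{a, b} \<in> edges G" "{b, c} \<in> edges G" "{c, d} \<in> edges G"
proof -
  obtain f where f: "bij_betw f (verts P) {..<4}"
      and E: "\<And>u v. u \<in> verts P \<Longrightarrow> v \<in> verts P \<Longrightarrow>
        {u, v} \<in> edges P \<longleftrightarrow> {f u, f v} \<in> {{i, Suc i} |i. Suc i < 4}"
    using assms by (auto simp: copy_of_P4_def isomorphic_def path_graph_def)
  have sub: "verts P \<subseteq> verts G" "edges P \<subseteq> edges G"
    using assms by (auto simp: copy_of_P4_def subgraph_def)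
  define g where "g = inv_into (verts P) f"
  have g: "bij_betw g {..<4} (verts P)"
    unfolding g_def using f by (rule bij_betw_inv_into)
  have fg: "f (g i) = i" "g i \<in> verts P" if "i < 4" for i
    using f g that bij_betw_inv_into_right[OF f, of i] by (auto simp: g_def bij_betw_def)
  have "{g i, g (Suc i)} \<in> edges P" if "Suc i < 4" for i
    using E[of "g i" "g (Suc i)"] fg[of i] fg[of "Suc i"] that by auto
  from this[of 0] this[of 1] this[of 2]
  have "{g 0, g 1} \<in> edges G" "{g 1, g 2} \<in> edges G" "{g 2, g 3} \<in> edges G"
    using sub by (auto simp: numeral_eq_Suc)
  moreover have four: "{..<4::nat} = {0, 1, 2, 3}" by auto
  have "verts P = {g 0, g 1, g 2, g 3}"
    using g unfolding bij_betw_def four by auto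
  moreover have "distinct [g 0, g 1, g 2, g 3]"
    using g unfolding bij_betw_def four by (auto simp: inj_on_def)
  ultimately show thesis using that sub by blast
qed

lemma leaf_unique_edge:
  assumes "v \<in> leaves G" "e \<in> edges G" "v \<in> e" "e' \<in> edges G" "v \<in> e'"
  shows "e = e'"
proof -
  have "card {e \<in> edges G. v \<in> e} = 1" using assms(1) by (simp add: leaves_def degree_def)
  then obtain x where x: "{e \<in> edges G. v \<in> e} = {x}" by (auto simp: card_1_singleton_iff)
  have "e \<in> {e \<in> edges G. v \<in> e}" "e' \<in> {e \<in> edges G. v \<in> e}" using assms by auto
  then show ?thesis unfolding x by simp
qed

text \<open>The inner vertices have two path edges each, so only the ends can be leaves. If both
  are, the middle edge joins the two non-leaves, and each of these is adjacent to an end.\<close>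

lemma copy_of_P4_leaves:
  assumes "copy_of_P4 P G"
  shows "finite (verts P)" "card (verts P) = 4" "card (leaves G \<inter> verts P) \<le> 2"
    and "card (leaves G \<inter> verts P) = 2 \<Longrightarrow>
      (\<exists>q\<in>edges G. q \<subseteq> verts P - leaves G) \<and>
      (\<forall>v\<in>verts P - leaves G. \<exists>u\<in>leaves G. {v, u} \<in> edges G)"
proof -
  obtain a b c d where P: "distinct [a, b, c, d]" "verts P = {a, b, c, d}"
      and E: "{a, b} \<in> edges G" "{b, c} \<in> edges G" "{c, d} \<in> edges G"
    using copy_of_P4E[OF assms] by metis
  show "finite (verts P)" "card (verts P) = 4" using P by auto
  have "b \<notin> leaves G" "c \<notin> leaves G"
    using leaf_unique_edge[of b G "{a, b}" "{b, c}"] leaf_unique_edge[of c G "{b, c}" "{c, d}"] P E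
    by (auto simp: doubleton_eq_iff)
  then have sub: "leaves G \<inter> verts P \<subseteq> {a, d}" using P by auto
  have ad: "card {a, d} = 2" using P by simp
  show "card (leaves G \<inter> verts P) \<le> 2"
    using card_mono[OF _ sub] ad by simp
  assume "card (leaves G \<inter> verts P) = 2"
  then have eq: "leaves G \<inter> verts P = {a, d}"
    using card_subset_eq[OF _ sub] ad by simp
  then have "verts P - leaves G = {b, c}" "a \<in> leaves G" "d \<in> leaves G" using P by auto
  then show "(\<exists>q\<in>edges G. q \<subseteq> verts P - leaves G) \<and>
      (\<forall>v\<in>verts P - leaves G. \<exists>u\<in>leaves G. {v, u} \<in> edges G)"
    using E by (auto simp: insert_commute)
qed

text \<open>Both counts are tight: the disjoint copies must use every vertex, and each must contain
  exactly two leaves. The middle edges then form \<open>Q\<close>.\<close>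

lemma corona_if_P4_cover:
  assumes simple: "simple_graph G"
    and C: "finite C" "\<And>P. P \<in> C \<Longrightarrow> copy_of_P4 P G"
      "pairwise (\<lambda>P Q. verts P \<inter> verts Q = {}) C"
    and cards: "card (verts G) = 4 * card C" "card (leaves G) = 2 * card C"
    and cover: "leaves G \<subseteq> (\<Union>P\<in>C. verts P)"
  obtains l Q where "corona G (verts G - leaves G) l" "matching G Q"
    "\<Union>Q \<subseteq> verts G - leaves G" "card Q = card C"
proof -
  let ?K = "verts G - leaves G"
  have finV: "finite (verts G)" using simple by (simp add: simple_graph_def)
  have leaf_sub: "leaves G \<subseteq> verts G" by (auto simp: leaves_def)
  note P4 = copy_of_P4_leaves[OF C(2)]
  have disj: "verts P \<inter> verts Q = {}" if "P \<in> C" "Q \<in> C" "P \<noteq> Q" for P Q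
    using C(3) that by (auto simp: pairwise_def)
  have "card (\<Union>P\<in>C. verts P) = (\<Sum>P\<in>C. card (verts P))"
    using C(1) P4(1) disj by (intro card_UN_disjoint) auto
  also have "\<dots> = 4 * card C" using P4(2) by simp
  finally have verts_eq: "(\<Union>P\<in>C. verts P) = verts G"
    using cards C(2) finV
    by (intro card_subset_eq) (auto simp: copy_of_P4_def subgraph_def)
  have "leaves G = (\<Union>P\<in>C. leaves G \<inter> verts P)" using cover by blast
  then have "card (leaves G) = card (\<Union>P\<in>C. leaves G \<inter> verts P)" by simp
  also have "\<dots> = (\<Sum>P\<in>C. card (leaves G \<inter> verts P))"
    using C(1) P4(1) disj by (intro card_UN_disjoint) auto
  finally have sum_eq: "(\<Sum>P\<in>C. card (leaves G \<inter> verts P)) = (\<Sum>P\<in>C. 2)"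
    using cards by simp
  have two: "card (leaves G \<inter> verts P) = 2" if "P \<in> C" for P
  proof (rule ccontr)
    assume "card (leaves G \<inter> verts P) \<noteq> 2"
    then have "card (leaves G \<inter> verts P) < 2" using P4(3)[OF that] by simp
    then have "(\<Sum>P\<in>C. card (leaves G \<inter> verts P)) < (\<Sum>P\<in>C. 2)"
      using C(1) P4(3) that by (intro sum_strict_mono_ex1) auto
    then show False using sum_eq by simp
  qed
  have "\<forall>v\<in>?K. \<exists>u\<in>leaves G. {v, u} \<in> edges G"
    using P4(4)[OF _ two] verts_eq by blast
  then obtain l where l: "\<And>v. v \<in> ?K \<Longrightarrow> l v \<in> leaves G \<and> {v, l v} \<in> edges G"
    by metis
  \<comment> \<open>A leaf has a single edge, hence a single neighbour.\<close>
  have inj: "inj_on l ?K"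
  proof (rule inj_onI)
    fix v w assume vw: "v \<in> ?K" "w \<in> ?K" "l v = l w"
    then have "{v, l v} = {w, l v}"
      using l[of v] l[of w] by (intro leaf_unique_edge[of "l v" G]) auto
    then show "v = w" by (auto simp: doubleton_eq_iff)
  qed
  have "card (l ` ?K) = card (leaves G)"
    using inj cards leaf_sub finV by (simp add: card_image card_Diff_subset finite_subset)
  \<comment> \<open>There are as many leaves as non-leaves. Surjectivity makes every edge at a leaf
    a pendant edge, which also excludes edges joining two leaves.\<close>
  then have surj: "l ` ?K = leaves G"
    using l leaf_sub finV by (intro card_subset_eq) (auto intro: finite_subset)
  have "corona G ?K l"
  proof
    fix e assume e: "e \<in> edges G"
    show "e \<subseteq> ?K \<or> (\<exists>v\<in>?K. e = {v, l v})"
    proof (cases "e \<subseteq> ?K")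
      case False
      then obtain x where x: "x \<in> e" "x \<in> leaves G"
        using e simple by (auto simp: simple_graph_def)
      then obtain v where v: "v \<in> ?K" "x = l v" using surj by blast
      then have "e = {v, l v}"
        using l[of v] x e by (intro leaf_unique_edge[of x G]) auto
      then show ?thesis using v by blast
    qed simp
  qed (use simple l inj in auto)
  moreover
  have "\<forall>P\<in>C. \<exists>q\<in>edges G. q \<subseteq> verts P - leaves G" using P4(4)[OF _ two] by blast
  then obtain q where q: "\<And>P. P \<in> C \<Longrightarrow> q P \<in> edges G \<and> q P \<subseteq> verts P - leaves G"
    by metis
  have q_ne: "q P \<noteq> {}" if "P \<in> C" for P
    using q[OF that] simple by (auto simp: simple_graph_def)
  have q_disj: "q P \<inter> q P' = {}" if "P \<in> C" "P' \<in> C" "P \<noteq> P'" for P P'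
    using disj[OF that] q[OF that(1)] q[OF that(2)] by blast
  have "disjoint (q ` C)" using q_disj by (intro pairwise_imageI) (simp add: disjnt_def)
  then have "matching G (q ` C)" using q by (auto simp: matching_def)
  moreover have "\<Union>(q ` C) \<subseteq> ?K" using q verts_eq by blast
  moreover have "inj_on q C" using q_ne q_disj by (intro inj_onI) blast
  then have "card (q ` C) = card C" by (rule card_image)
  ultimately show thesis using that by blast
qed

theorem theorem4p2:
  fixes F :: "'a graph" and n :: nat
  assumes "8 dvd n"
    and "forest F"
    and "card (verts F) = n"
    and "card (leaves F) = n div 2"
    and "\<exists>C. card C = n div 4 \<and> (\<forall>P\<in>C. copy_of_P4 P F) \<and>
           pairwise (\<lambda>P Q. verts P \<inter> verts Q = {}) C \<and>
           leaves F \<subseteq> (\<Union>P\<in>C. verts P)"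
  shows "real (game_matching_number F) = 3 / 4 * real (matching_number F)
       \<and> 3 / 4 * real (matching_number F) = 3 / 8 * real n"
proof -
  obtain s where s: "n = 8 * s" using assms(1) by blast
  have simple: "simple_graph F" using assms(2) by (simp add: forest_def)
  then have finV: "finite (verts F)" by (simp add: simple_graph_def)
  have leaf_sub: "leaves F \<subseteq> verts F" by (auto simp: leaves_def)
  obtain C where C: "finite C" "card C = 2 * s" "\<And>P. P \<in> C \<Longrightarrow> copy_of_P4 P F"
      "pairwise (\<lambda>P Q. verts P \<inter> verts Q = {}) C" "leaves F \<subseteq> (\<Union>P\<in>C. verts P)"
  proof (cases "s = 0")
    case True
    \<comment> \<open>The given family could be infinite here, since infinite sets have cardinality \<open>0\<close>.\<close>
    then have "verts F = {}" using assms(3) s finV by simp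
    then show thesis using that[of "{}"] True leaf_sub by simp
  next
    case False
    obtain C where "card C = n div 4" "\<forall>P\<in>C. copy_of_P4 P F"
        "pairwise (\<lambda>P Q. verts P \<inter> verts Q = {}) C" "leaves F \<subseteq> (\<Union>P\<in>C. verts P)"
      using assms(5) by blast
    then show thesis using that[of C] False s by (simp add: card_ge_0_finite)
  qed
  obtain l Q where corona: "corona F (verts F - leaves F) l" and Q: "matching F Q"
      "\<Union>Q \<subseteq> verts F - leaves F" "card Q = 2 * s"
    using corona_if_P4_cover[OF simple C(1,3,4) _ _ C(5)] assms(3,4) s C(2) by auto
  have "card (verts F - leaves F) = 4 * s"
    using assms(3,4) s leaf_sub finV by (simp add: card_Diff_subset finite_subset)
  \<comment> \<open>With \<open>4 * s\<close> core vertices and \<open>2 * s\<close> edges in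
    \<open>Q\<close>, both bounds subtract exactly \<open>s\<close> core edges.\<close>
  then have "game_matching_number F = 3 * s" "matching_number F = 4 * s"
    using corona.game_value_lower[OF corona assms(2)] corona.game_value_upper[OF corona Q(1,2)]
      corona.matching_number_eq[OF corona] Q(3) by simp_all
  then show ?thesis using s by simp
qed

end
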